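(* Let $P=(X,\prec)$ and $Q=(X,\prec')$ be two posets on the same set $X$ with $|X|=n$ elements, and let $k$ be a positive integer. Suppose that $|C\cap C'|\le k$ for every chain $C$ of $P$ and every chain $C'$ of $Q$. Then $$e(P)\,e(Q)\ \ge\ \frac{n!}{k^{n-k}\,k!}.$$
   Context: A chain of a poset is a subset of pairwise comparable elements. $e(P)$ denotes the number of linear extensions of $P$, i.e. bijections $f:X\to[n]$ with $f(x)<f(y)$ whenever $x\prec y$.
   Formalization: For k > n the exponent n−k is read as 0, since the bound with a negative exponent is false (n = 1, k = 3 would require 1 ≥ 3/2); for k ≤ n the inequality is exactly as stated. *)

theory Defs
  imports Complex_Main "HOL-Library.FuncSet"
begin

text \<open>
  A poset on \<open>X\<close> is given by its reflexive order relation \<open>r\<close>, with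
  \<open>partial_order_on X r\<close> (which includes \<open>r \<subseteq> X \<times> X\<close>); the strict order \<open>x \<prec> y\<close> is
  \<open>(x, y) \<in> r \<and> x \<noteq> y\<close>.  Reflexivity is what makes \<^const>\<open>Chains\<close> the set of all
  chains, since its condition also ranges over pairs of equal elements.
\<close>

text \<open>
  Linear extensions are functions on all of \<open>'a\<close>; they are taken extensional
  (\<open>undefined\<close> outside \<open>X\<close>) so that each bijection \<open>X \<rightarrow> {1..n}\<close> is counted exactly once.
\<close>

definition linear_extensions :: "'a set \<Rightarrow> 'a rel \<Rightarrow> ('a \<Rightarrow> nat) set" where
  "linear_extensions X r =
     {f \<in> X \<rightarrow>\<^sub>E {1..card X}. bij_betw f X {1..card X} \<and>
        (\<forall>x\<in>X. \<forall>y\<in>X. (x, y) \<in> r \<and> x \<noteq> y \<longrightarrow> f x < f y)}"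

definition num_linear_extensions :: "'a set \<Rightarrow> 'a rel \<Rightarrow> nat" where
  "num_linear_extensions X r = card (linear_extensions X r)"

end

theory Submission
  imports Defs
begin

text \<open>
  The promotion path of a linear extension of \<open>P\<close> is a chain of \<open>P\<close>, and sliding along the path
  shows that a given \<open>x\<close> lies on the promotion paths of at least \<open>e(P - x)\<close> linear extensions.
  Counting triples \<open>(f, g, x)\<close>, where \<open>x\<close> lies on the path of \<open>f\<close> in \<open>P\<close> and on that of \<open>g\<close> in
  \<open>Q\<close>, therefore gives
  \<open>(\<Sum>x. e(P - x) e(Q - x)) \<le> k e(P) e(Q)\<close>,
  and the theorem follows by induction on \<open>n\<close>, starting from the trivial case \<open>n \<le> k\<close>.
\<close>

section \<open>Linear extensions as lists; promotion paths and their inverse\<close>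

definition strict_of :: "'a rel \<Rightarrow> 'a \<Rightarrow> 'a \<Rightarrow> bool" where
  "strict_of r a b \<longleftrightarrow> (a, b) \<in> r \<and> a \<noteq> b"

text \<open>Lists are read from the top down.\<close>

definition extension_lists :: "'a set \<Rightarrow> 'a rel \<Rightarrow> 'a list set" where
  "extension_lists S r =
     {xs. distinct xs \<and> set xs = S \<and> sorted_wrt (\<lambda>a b. \<not> strict_of r a b) xs}"

text \<open>This is Schuetzenberger's promotion path, started at the top: when the current element
  is removed, the next entry below it would slide into its place.\<close>

fun promotion_path :: "'a rel \<Rightarrow> 'a list \<Rightarrow> 'a set" where
  "promotion_path r [] = {}"
| "promotion_path r [p] = {p}"
| "promotion_path r (p # q # xs) =
     (if strict_of r q p then insert p (promotion_path r (q # xs)) else promotion_path r (p # xs))"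

text \<open>
  Inverse promotion: \<open>x\<close> enters at the bottom and moves up until it meets a larger element,
  which then moves up in its place, and so on.
\<close>

fun promotion_insert :: "'a rel \<Rightarrow> 'a \<Rightarrow> 'a list \<Rightarrow> 'a list" where
  "promotion_insert r x [] = [x]"
| "promotion_insert r x (z # zs) =
     (case promotion_insert r x zs of
        c # ys \<Rightarrow> if strict_of r c z then z # c # ys else c # z # ys)"

lemma strict_of_trans:
  "\<lbrakk>trans r; antisym r; strict_of r a b; strict_of r b c\<rbrakk> \<Longrightarrow> strict_of r a c"
  unfolding strict_of_def by (metis antisymD transD)

lemma strict_of_asym: "\<lbrakk>antisym r; strict_of r a b\<rbrakk> \<Longrightarrow> \<not> strict_of r b a"
  unfolding strict_of_def by (metis antisymD)

lemma finite_extension_lists: "finite S \<Longrightarrow> finite (extension_lists S r)"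
  by (rule finite_subset[OF _ finite_subset_distinct]) (auto simp: extension_lists_def)

section \<open>Promotion paths are chains\<close>

lemma promotion_path_subset: "promotion_path r xs \<subseteq> set xs"
  by (induction r xs rule: promotion_path.induct) auto

text \<open>Every step of the path goes strictly down, so transitivity places all later elements
  below its start. This supplies the comparabilities for
  \<open>promotion_path_chain\<close>.\<close>

lemma promotion_path_le_hd:
  assumes "trans r" "antisym r"
  shows "y \<in> promotion_path r (p # xs) \<Longrightarrow> y = p \<or> strict_of r y p"
proof (induction xs arbitrary: p)
  case (Cons q xs)
  then show ?case
    using strict_of_trans[OF assms, of y q p] by (auto split: if_splits)
qed simp

lemma promotion_path_chain:
  "\<lbrakk>partial_order_on X r; set xs \<subseteq> X\<rbrakk> \<Longrightarrow> promotion_path r xs \<in> Chains r"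
proof (induction r xs rule: promotion_path.induct)
  case (2 r p)
  then show ?case
    by (auto simp: Chains_def partial_order_on_def preorder_on_def refl_on_def)
next
  case (3 r p q xs)
  have r: "trans r" "antisym r" "(p, p) \<in> r"
    using "3.prems" by (auto simp: partial_order_on_def preorder_on_def refl_on_def)
  show ?case
  proof (cases "strict_of r q p")
    case True
    have "(y, p) \<in> r" if "y \<in> promotion_path r (q # xs)" for y
      using promotion_path_le_hd[OF r(1,2) that] True strict_of_trans[OF r(1,2), of y q p]
      by (auto simp: strict_of_def)
    with "3.IH"(1)[OF True] "3.prems" True r(3) show ?thesis
      by (auto simp: Chains_def)
  qed (use "3.IH"(2) "3.prems" in simp)
qed (simp add: Chains_def)

section \<open>Inverse promotion: validity, path and injectivity\<close>

lemma promotion_insert_eq_Cons: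
  obtains c ys where "promotion_insert r x zs = c # ys"
proof -
  have "\<exists>c ys. promotion_insert r x zs = c # ys"
  proof (induction zs)
    case (Cons z zs)
    then obtain c ys where "promotion_insert r x zs = c # ys" by blast
    then show ?case by simp
  qed simp
  with that show thesis by blast
qed

lemma set_promotion_insert: "set (promotion_insert r x zs) = insert x (set zs)"
proof (induction zs)
  case (Cons z zs)
  obtain c ys where "promotion_insert r x zs = c # ys" by (rule promotion_insert_eq_Cons)
  with Cons show ?case by auto
qed simp

lemma length_promotion_insert: "length (promotion_insert r x zs) = Suc (length zs)"
proof (induction zs)
  case (Cons z zs)
  obtain c ys where "promotion_insert r x zs = c # ys" by (rule promotion_insert_eq_Cons)
  with Cons show ?case by auto
qed simp

lemma promotion_insert_eq_imp_length_eq: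
  "promotion_insert r x zs = promotion_insert r x zs' \<Longrightarrow> length zs = length zs'"
  by (drule arg_cong[where f = length]) (simp only: length_promotion_insert nat.inject)

text \<open>The head is the element that is currently moving up. The role is only ever handed to a
  strictly larger element, so the mover is \<open>x\<close> or lies above \<open>x\<close>.\<close>

lemma hd_promotion_insert:
  assumes "trans r" "antisym r" "promotion_insert r x zs = c # ys"
  shows "c = x \<or> (c \<in> set zs \<and> strict_of r x c)"
  using assms(3)
proof (induction zs arbitrary: c ys)
  case (Cons z zs)
  obtain d ds where d: "promotion_insert r x zs = d # ds" by (rule promotion_insert_eq_Cons)
  show ?case
    using Cons.IH[OF d] Cons.prems d strict_of_trans[OF assms(1,2), of x d z]
    by (auto split: if_splits)
qed simp

lemma promotion_insert_mem:
  assumes r: "trans r" "antisym r" and x: "x \<notin> S"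
  shows "zs \<in> extension_lists S r \<Longrightarrow> promotion_insert r x zs \<in> extension_lists (insert x S) r"
  using x
proof (induction zs arbitrary: S)
  case Nil
  then show ?case by (auto simp: extension_lists_def)
next
  case (Cons z zs)
  obtain c ys where c: "promotion_insert r x zs = c # ys" by (rule promotion_insert_eq_Cons)
  have "zs \<in> extension_lists (set zs) r" "x \<notin> set zs"
    using Cons.prems by (auto simp: extension_lists_def)
  note IH = Cons.IH[OF this]
  have hd: "c = x \<or> (c \<in> set zs \<and> strict_of r x c)"
    by (rule hd_promotion_insert[OF r c])
  have set: "insert c (set ys) = insert x (set zs)"
    using set_promotion_insert[of r x zs] c by simp
  have S: "S = insert z (set zs)" "z \<notin> set zs" "z \<noteq> x"
    using Cons.prems by (auto simp: extension_lists_def)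
  have z: "\<not> strict_of r z y" if "y \<in> set zs" for y
    using Cons.prems that by (auto simp: extension_lists_def)
  have ys: "distinct (c # ys)" "sorted_wrt (\<lambda>a b. \<not> strict_of r a b) (c # ys)"
    using IH c by (auto simp: extension_lists_def)
  show ?case
  proof (cases "strict_of r c z")
    case True
    \<comment> \<open>The mover \<open>c\<close> hands over to \<open>z\<close>. The only new entry
      below \<open>z\<close> in the list is \<open>x\<close>, and asymmetry excludes
      \<open>z\<close> below \<open>x\<close>.\<close>
    then have "strict_of r x z"
      using hd strict_of_trans[OF r, of x c z] by auto
    then have "\<not> strict_of r z y" if "y \<in> set (c # ys)" for y
      using that set z strict_of_asym[OF r(2)] by auto
    with True ys set S c show ?thesis
      by (auto simp: extension_lists_def)
  next
    case False
    have "\<not> strict_of r z y" if "y \<in> set ys" for y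
    \<comment> \<open>If \<open>x\<close> occurs in \<open>ys\<close>, then \<open>c\<close> is not
      \<open>x\<close>, so \<open>c\<close> lies above \<open>x\<close>. Thus \<open>z\<close> below
      \<open>x\<close> would put \<open>z\<close> below \<open>c\<close>, although \<open>z\<close>
      precedes \<open>c\<close> in the old list.\<close>
    proof (cases "y = x")
      case True
      then have "c \<in> set zs" "strict_of r x c"
        using hd ys(1) that by auto
      then show ?thesis
        using z[of c] True strict_of_trans[OF r, of z x c] by blast
    next
      case False
      then show ?thesis using set that z by auto
    qed
    with False ys set S c show ?thesis
      by (auto simp: extension_lists_def)
  qed
qed

text \<open>The path retraces the movers downwards: each handover becomes a step down, and an entry
  overtaken by \<open>c\<close> is skipped. The skip may fail only for \<open>c = x\<close>, but
  then \<open>x\<close> heads the list and is on the path anyway.\<close>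

lemma promotion_path_insert:
  assumes r: "trans r" "antisym r"
  shows "zs \<in> extension_lists S r \<Longrightarrow> x \<in> promotion_path r (promotion_insert r x zs)"
proof (induction zs arbitrary: S)
  case (Cons z zs)
  obtain c ys where c: "promotion_insert r x zs = c # ys" by (rule promotion_insert_eq_Cons)
  have "zs \<in> extension_lists (set zs) r"
    using Cons.prems by (auto simp: extension_lists_def)
  note IH = Cons.IH[OF this]
  show ?case
    using Cons.prems IH hd_promotion_insert[OF r c] c
    by (auto simp: extension_lists_def)
qed simp

text \<open>The first two entries of the result reveal whether the last comparison was a handover or
  an overtaking, so the insertion can be undone step by step.\<close>

lemma promotion_insert_inj:
  assumes r: "trans r" "antisym r"
  shows "\<lbrakk>zs \<in> extension_lists S r; zs' \<in> extension_lists T r; x \<notin> S; x \<notin> T;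
          promotion_insert r x zs = promotion_insert r x zs'\<rbrakk> \<Longrightarrow> zs = zs'"
proof (induction zs arbitrary: zs' S T)
  case Nil
  from promotion_insert_eq_imp_length_eq[OF Nil(5)] show ?case by simp
next
  case (Cons z zs)
  obtain z' vs where zs': "zs' = z' # vs"
    using promotion_insert_eq_imp_length_eq[OF Cons.prems(5)] by (cases zs') auto
  obtain c ys where c: "promotion_insert r x zs = c # ys" by (rule promotion_insert_eq_Cons)
  obtain d ws where d: "promotion_insert r x vs = d # ws" by (rule promotion_insert_eq_Cons)
  have "zs \<in> extension_lists (set zs) r" "x \<notin> set zs" "vs \<in> extension_lists (set vs) r" "x \<notin> set vs"
    using Cons.prems zs' by (auto simp: extension_lists_def)
  note IH = Cons.IH[OF this(1,3,2,4)]
  have x: "z \<noteq> x" "z' \<noteq> x"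
    using Cons.prems zs' by (auto simp: extension_lists_def)
  have not_above: "\<not> strict_of r z c" if "c \<noteq> x"
    using that hd_promotion_insert[OF r c] Cons.prems(1) by (auto simp: extension_lists_def)
  have not_above': "\<not> strict_of r z' d" if "d \<noteq> x"
    using that hd_promotion_insert[OF r d] Cons.prems(2) zs' by (auto simp: extension_lists_def)
  have eq: "(if strict_of r c z then z # c # ys else c # z # ys)
            = (if strict_of r d z' then z' # d # ws else d # z' # ws)"
    using Cons.prems(5) c d zs' by simp
  \<comment> \<open>After a handover the head is not \<open>x\<close> and the second entry lies
    below it. After an overtaking, the head is \<open>x\<close> or the second entry does not lie
    below it.\<close>
  then have "strict_of r c z \<longleftrightarrow> strict_of r d z'"
    using x not_above not_above' by (metis list.inject)
  with eq have "z = z'" "c # ys = d # ws"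
    by (auto split: if_splits)
  with IH c d zs' show ?case by simp
qed

section \<open>Counting and induction\<close>

lemma extension_lists_remove_le:
  assumes r: "trans r" "antisym r" and "finite S" "x \<in> S"
  shows "card (extension_lists (S - {x}) r)
           \<le> card {f \<in> extension_lists S r. x \<in> promotion_path r f}"
proof (rule card_inj_on_le[where f = "promotion_insert r x"])
  show "inj_on (promotion_insert r x) (extension_lists (S - {x}) r)"
    by (rule inj_onI, rule promotion_insert_inj[OF r, where S="S - {x}" and T="S - {x}"]) auto
  show "promotion_insert r x ` extension_lists (S - {x}) r
          \<subseteq> {f \<in> extension_lists S r. x \<in> promotion_path r f}"
    using promotion_insert_mem[OF r, of x "S - {x}"] promotion_path_insert[OF r] \<open>x \<in> S\<close>
    by (auto simp: insert_absorb)
qed (simp add: finite_extension_lists \<open>finite S\<close>)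

text \<open>Inserting the elements one by one with \<open>promotion_insert\<close> builds a linear
  extension; this feeds the base case of the final induction.\<close>

lemma card_extension_lists_pos:
  assumes r: "trans r" "antisym r" and "finite S"
  shows "card (extension_lists S r) > 0"
  using \<open>finite S\<close>
proof (induction S rule: finite_induct)
  case empty
  have "extension_lists {} r = {[]}" by (auto simp: extension_lists_def)
  then show ?case by simp
next
  case (insert x S)
  then obtain zs where "zs \<in> extension_lists S r"
    by (metis card_gt_0_iff ex_in_conv)
  with promotion_insert_mem[OF r insert.hyps(2)] insert.hyps(1) show ?case
    using finite_extension_lists[of "insert x S" r] by (auto simp: card_gt_0_iff)
qed

lemma sum_extension_lists_remove_le:
  assumes P: "partial_order_on X P" and Q: "partial_order_on X Q" and S: "finite S" "S \<subseteq> X"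
    and k: "\<And>C C'. C \<in> Chains P \<Longrightarrow> C' \<in> Chains Q \<Longrightarrow> card (C \<inter> C') \<le> k"
  shows "(\<Sum>x\<in>S. card (extension_lists (S - {x}) P) * card (extension_lists (S - {x}) Q))
           \<le> k * (card (extension_lists S P) * card (extension_lists S Q))"
proof -
  let ?L = "extension_lists S P" and ?M = "extension_lists S Q"
  let ?p = "promotion_path P" and ?q = "promotion_path Q"
  have po: "trans P" "antisym P" "trans Q" "antisym Q"
    using P Q by (auto simp: partial_order_on_def preorder_on_def)
  have fin: "finite ?L" "finite ?M"
    by (simp_all add: finite_extension_lists S)
  have "(\<Sum>x\<in>S. card (extension_lists (S - {x}) P) * card (extension_lists (S - {x}) Q))
      \<le> (\<Sum>x\<in>S. card {f \<in> ?L. x \<in> ?p f} * card {g \<in> ?M. x \<in> ?q g})"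
    by (intro sum_mono mult_mono extension_lists_remove_le po S) auto
  also have "\<dots> = (\<Sum>x\<in>S. card ({f \<in> ?L. x \<in> ?p f} \<times> {g \<in> ?M. x \<in> ?q g}))"
    by (simp add: card_cartesian_product)
  also have "\<dots> = (\<Sum>x\<in>S. card {h \<in> ?L \<times> ?M. x \<in> ?p (fst h) \<inter> ?q (snd h)})"
    by (intro sum.cong refl arg_cong[where f = card]) auto
  \<comment> \<open>Double counting: the triples are regrouped by the pair \<open>h\<close> of
    extensions. Its two paths are chains of \<open>P\<close> and \<open>Q\<close>, so they share at
    most \<open>k\<close> elements.\<close>
  also have "\<dots> = (\<Sum>h\<in>?L \<times> ?M. card {x \<in> S. x \<in> ?p (fst h) \<inter> ?q (snd h)})"
    by (rule sum_multicount_gen) (simp_all add: S fin)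
  also have "\<dots> \<le> (\<Sum>h\<in>?L \<times> ?M. k)"
  proof (rule sum_mono)
    fix h assume "h \<in> ?L \<times> ?M"
    then have h: "set (fst h) = S" "set (snd h) = S"
      by (simp_all add: extension_lists_def mem_Times_iff)
    then have "{x \<in> S. x \<in> ?p (fst h) \<inter> ?q (snd h)} = ?p (fst h) \<inter> ?q (snd h)"
      using promotion_path_subset[of P "fst h"] by blast
    with h S show "card {x \<in> S. x \<in> ?p (fst h) \<inter> ?q (snd h)} \<le> k"
      using k[OF promotion_path_chain[OF P, of "fst h"] promotion_path_chain[OF Q, of "snd h"]]
      by simp
  qed
  finally show ?thesis by (simp add: card_cartesian_product mult_ac)
qed

lemma fact_le_extension_lists:
  assumes P: "partial_order_on X P" and Q: "partial_order_on X Q"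
    and k: "\<And>C C'. C \<in> Chains P \<Longrightarrow> C' \<in> Chains Q \<Longrightarrow> card (C \<inter> C') \<le> k"
  shows "finite S \<Longrightarrow> S \<subseteq> X \<Longrightarrow>
    fact (card S) \<le> card (extension_lists S P) * card (extension_lists S Q) * (k ^ (card S - k) * fact k)"
proof (induction "card S" arbitrary: S rule: less_induct)
  case less
  let ?e = "\<lambda>S. card (extension_lists S P) * card (extension_lists S Q)"
  show ?case
  proof (cases "card S \<le> k")
    case True
    \<comment> \<open>Truncated subtraction makes the exponent 0 here, so positivity and
      monotonicity of the factorial suffice.\<close>
    have "1 \<le> ?e S"
      using P Q less.prems(1) card_extension_lists_pos[of P S] card_extension_lists_pos[of Q S]
      by (simp add: partial_order_on_def preorder_on_def Suc_le_eq)
    with True show ?thesis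
      using mult_mono[OF \<open>1 \<le> ?e S\<close> fact_mono_nat[OF True]] by simp
  next
    case False
    then obtain m where m: "card S = Suc m" "k \<le> m" by (cases "card S") auto
    \<comment> \<open>The factor \<open>Suc m\<close> is spread over the elements of
      \<open>S\<close>, one summand for each element to be removed.\<close>
    have "fact (card S) = (\<Sum>x\<in>S. fact m)" by (simp add: m)
    also have "\<dots> \<le> (\<Sum>x\<in>S. ?e (S - {x}) * (k ^ (m - k) * fact k))"
    proof (rule sum_mono)
      fix x assume "x \<in> S"
      then have "card (S - {x}) = m" using m less.prems by simp
      then show "fact m \<le> ?e (S - {x}) * (k ^ (m - k) * fact k)"
        using less.hyps[of "S - {x}"] m less.prems by auto
    qed
    also have "\<dots> = (\<Sum>x\<in>S. ?e (S - {x})) * (k ^ (m - k) * fact k)"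
      by (simp add: sum_distrib_right)
    also have "\<dots> \<le> k * ?e S * (k ^ (m - k) * fact k)"
      by (intro mult_right_mono sum_extension_lists_remove_le[OF P Q less.prems k]) auto
    \<comment> \<open>Since \<open>k \<le> m\<close>, the exponent for \<open>S\<close> is one more
      than \<open>m - k\<close>, which absorbs the extra factor \<open>k\<close>.\<close>
    also have "\<dots> = ?e S * (k ^ (card S - k) * fact k)"
      using m by (simp add: Suc_diff_le mult_ac)
    finally show ?thesis .
  qed
qed

section \<open>From lists to labellings\<close>

lemma card_extension_lists_le:
  assumes "finite X"
  shows "card (extension_lists X r) \<le> num_linear_extensions X r"
proof -
  define n where "n = card X"
  \<comment> \<open>Positions count from 0 at the top, so \<open>n - i\<close> gives the top entry
    label \<open>n\<close> and the bottom entry label 1; restriction to \<open>X\<close> makes the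
    labelling extensional.\<close>
  define F where "F xs = (\<lambda>y\<in>X. n - inv_into {..<n} ((!) xs) y)" for xs :: "'a list"
  have nth: "bij_betw ((!) xs) {..<n} X" if "xs \<in> extension_lists X r" for xs
    using that by (intro bij_betw_nth) (auto simp: extension_lists_def n_def distinct_card)
  have F: "F xs (xs ! i) = n - i" if "xs \<in> extension_lists X r" "i < n" for xs i
    using that nth[OF that(1)] bij_betwE[OF nth[OF that(1)]]
    by (simp add: F_def bij_betw_inv_into_left)
  show ?thesis
    unfolding num_linear_extensions_def
  proof (rule card_inj_on_le)
    show "inj_on F (extension_lists X r)"
    proof (rule inj_onI)
      fix xs ys assume xs: "xs \<in> extension_lists X r" and ys: "ys \<in> extension_lists X r" and eq: "F xs = F ys"
      have len: "length xs = n" "length ys = n"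
        using xs ys distinct_card[of xs] distinct_card[of ys]
        by (auto simp: extension_lists_def n_def)
      show "xs = ys"
      proof (rule nth_equalityI)
        fix i assume "i < length xs"
        then have i: "i < n" using len by simp
        obtain j where j: "j < n" "xs ! i = ys ! j"
          using bij_betwE[OF nth[OF xs]] bij_betw_imp_surj_on[OF nth[OF ys]] i
          by (metis imageE lessThan_iff)
        then have "n - i = n - j" using F[OF xs i] F[OF ys j(1)] eq by simp
        then have "i = j" using i j(1) by simp
        then show "xs ! i = ys ! i" using i j by simp
      qed (simp add: len)
    qed
    show "F ` extension_lists X r \<subseteq> linear_extensions X r"
    proof
      fix f assume "f \<in> F ` extension_lists X r"
      then obtain xs where xs: "xs \<in> extension_lists X r" and f: "f = F xs" by blast
      have ex: "\<exists>i<n. y = xs ! i" if "y \<in> X" for y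
        using bij_betw_imp_surj_on[OF nth[OF xs]] that by auto
      have "inj_on f X"
        by (rule inj_onI) (use ex F[OF xs] f in \<open>metis diff_diff_cancel less_imp_le\<close>)
      moreover have "f ` X \<subseteq> {1..n}"
        using ex F[OF xs] f by fastforce
      ultimately have bij: "bij_betw f X {1..n}"
        by (simp add: bij_betw_def card_image card_subset_eq n_def)
      have "f x < f y" if "x \<in> X" "y \<in> X" "strict_of r x y" for x y
      proof -
        obtain i j where ij: "i < n" "x = xs ! i" "j < n" "y = xs ! j"
          using ex \<open>x \<in> X\<close> \<open>y \<in> X\<close> by blast
        \<comment> \<open>The list order forbids a smaller element before a larger one, and
          \<open>n - i\<close> reverses positions.\<close>
        have "j < i"
        proof (rule ccontr)
          assume "\<not> j < i"
          then have "i < j" using that ij by (cases "i = j") (auto simp: strict_of_def)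
          then show False
            using xs ij that by (auto simp: extension_lists_def sorted_wrt_iff_nth_less n_def distinct_card)
        qed
        then show ?thesis using ij F[OF xs] f by simp
      qed
      then show "f \<in> linear_extensions X r"
        using bij bij_betwE[OF bij] f
        by (auto simp: linear_extensions_def strict_of_def n_def F_def)
    qed
    show "finite (linear_extensions X r)"
      by (rule finite_subset[of _ "X \<rightarrow>\<^sub>E {1..card X}"])
         (auto simp: linear_extensions_def assms intro!: finite_PiE)
  qed
qed

theorem theorem1p6:
  fixes X :: "'a set" and P Q :: "'a rel" and n k :: nat
  assumes "finite X" and "card X = n"
    and "partial_order_on X P" and "partial_order_on X Q"
    and "k > 0"
    and "\<And>C C'. C \<in> Chains P \<Longrightarrow> C' \<in> Chains Q \<Longrightarrow> card (C \<inter> C') \<le> k"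
  shows "real (num_linear_extensions X P) * real (num_linear_extensions X Q)
           \<ge> fact n / (real k ^ (n - k) * fact k)"
proof -
  have "fact n \<le> card (extension_lists X P) * card (extension_lists X Q) * (k ^ (n - k) * fact k)"
    using fact_le_extension_lists[OF assms(3,4,6) assms(1) order_refl] assms(2) by simp
  also have "\<dots> \<le> num_linear_extensions X P * num_linear_extensions X Q * (k ^ (n - k) * fact k)"
    by (intro mult_mono card_extension_lists_le assms) auto
  finally have "real (fact n)
      \<le> real (num_linear_extensions X P * num_linear_extensions X Q * (k ^ (n - k) * fact k))"
    by (rule of_nat_mono)
  with \<open>k > 0\<close> show ?thesis by (simp add: divide_le_eq)
qed

end
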